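(* Let $q$ be a power of a prime, let $m$ be a positive integer, and let $Q = (q^m-1)/(q-1)$. Let $D$ be the smallest positive divisor of $q-1$ such that $(q-1)/D$ is coprime to $Q$, and let $N \mid q^m-1$ be such that $DQ \mid N$. Then $$Z_{q,m,N}(0) = \frac{q^m-1}{N}\, P_{q,m,N}(0).$$ In particular we have the following relation: $$P_{q,m,q^m-1}(0) = \frac{\phi(q^m-1)}{\phi(DQ)}\, P_{q,m,DQ}(0).$$
   Context: $\phi$ is Euler's function. For a positive divisor $N$ of $q^m-1$, a non-zero element $\xi \in \mathbb{F}_{q^m}^*$ is called $N$-free if, for any $d \mid N$, $\xi = \gamma^d$ with $\gamma \in \mathbb{F}_{q^m}$ implies $d=1$; equivalently $\xi = \alpha^k$ for some integer $k$ coprime to $N$, where $\alpha$ is a primitive element of $\mathbb{F}_{q^m}$. For $c \in \mathbb{F}_q$, $Z_{q,m,N}(c)$ denotes the number of $N$-free elements $\xi \in \mathbb{F}_{q^m}^*$ with $\operatorname{Tr}_{\mathbb{F}_{q^m}/\mathbb{F}_q}(\xi) = c$, and $P_{q,m,N}(c)$ denotes the number of elements $\zeta \in \mathbb{F}_{q^m}^*$ of multiplicative order $N$ with $\operatorname{Tr}_{\mathbb{F}_{q^m}/\mathbb{F}_q}(\zeta) = c$. *)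

theory Defs
  imports "HOL-Algebra.Algebra" "HOL-Number_Theory.Number_Theory"
begin

text \<open>
  Throughout, \<open>R\<close> is a field with \<open>q ^ m\<close> elements (\<open>q\<close> a prime power), and its subfield with
  \<open>q\<close> elements is the fixed field of the Frobenius automorphism \<open>x \<mapsto> x ^ q\<close>, which generates
  the Galois group; the trace down to this subfield is the sum of the \<open>m\<close> conjugates.
\<close>

definition field_trace :: "('a, 'b) ring_scheme \<Rightarrow> nat \<Rightarrow> nat \<Rightarrow> 'a \<Rightarrow> 'a" where
  "field_trace R q m x = (\<Oplus>\<^bsub>R\<^esub>i\<in>{..<m}. x [^]\<^bsub>R\<^esub> (q ^ i))"

definition N_free :: "('a, 'b) ring_scheme \<Rightarrow> nat \<Rightarrow> 'a \<Rightarrow> bool" where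
  "N_free R N \<xi> \<longleftrightarrow> \<xi> \<in> carrier R - {\<zero>\<^bsub>R\<^esub>} \<and>
     (\<forall>d::nat. d dvd N \<longrightarrow> (\<exists>\<gamma>\<in>carrier R. \<xi> = \<gamma> [^]\<^bsub>R\<^esub> d) \<longrightarrow> d = 1)"

definition Z_count :: "('a, 'b) ring_scheme \<Rightarrow> nat \<Rightarrow> nat \<Rightarrow> nat \<Rightarrow> 'a \<Rightarrow> nat" where
  "Z_count R q m N c = card {\<xi> \<in> carrier R - {\<zero>\<^bsub>R\<^esub>}. N_free R N \<xi> \<and> field_trace R q m \<xi> = c}"

definition P_count :: "('a, 'b) ring_scheme \<Rightarrow> nat \<Rightarrow> nat \<Rightarrow> nat \<Rightarrow> 'a \<Rightarrow> nat" where
  "P_count R q m N c =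
     card {\<zeta> \<in> carrier R - {\<zero>\<^bsub>R\<^esub>}. group.ord (Multiplicative_Group.mult_of R) \<zeta> = N \<and>
           field_trace R q m \<zeta> = c}"

end

theory Submission
  imports Defs
begin

text \<open>
  The multiplicative group of \<open>R\<close> is cyclic of order \<open>(q - 1) * Q\<close>; write its elements as powers
  \<open>g ^ k\<close> of a primitive element. Its subgroup generated by \<open>g ^ Q\<close> is the multiplicative group of
  the field with \<open>q\<close> elements, and the trace is linear over that field. So whether
  \<open>g ^ k\<close> has trace \<open>0\<close> depends only on \<open>k mod Q\<close> (\<open>field_trace_pow_eq_zero_iff_mod\<close>).

  Put \<open>L = D * Q\<close> and \<open>E = (q - 1) / D\<close>. The group order is \<open>L * E\<close>, and the minimality of \<open>D\<close>
  makes \<open>L\<close> and \<open>E\<close> coprime (\<open>coprime_least_cofactor\<close>). By the Chinese remainder theorem the exponent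
  \<open>k\<close> amounts to an independent choice of \<open>k mod L\<close> and \<open>k mod E\<close>, and the vanishing of
  the trace concerns only the former. Now let \<open>N = L * e\<close> with \<open>E = e * f\<close>. The power \<open>g ^ k\<close> is
  \<open>N\<close>-free iff \<open>k\<close> is coprime to \<open>L\<close> and to \<open>e\<close>, and it has order \<open>N\<close> iff \<open>k\<close> is coprime to \<open>L\<close>
  and \<open>gcd k E = f\<close>. Hence both counts share the factor \<open>T\<close>, the number of units modulo \<open>L\<close> whose power
  has trace \<open>0\<close>, and the remaining factors are \<open>f * totient e\<close> for the
  \<open>N\<close>-free elements and \<open>totient e\<close> for the elements of order \<open>N\<close> (\<open>trace_zero_counts\<close>). Their ratio
  is \<open>f = (q ^ m - 1) / N\<close>. The second relation compares the order counts
  for \<open>e = E\<close> and \<open>e = 1\<close>.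
\<close>

section \<open>Counting residues\<close>

text \<open>The Chinese remainder theorem as a counting principle: conditions modulo coprime \<open>L\<close> and \<open>E\<close> are
  independent.\<close>

lemma card_residue_pairs:
  fixes L E :: nat
  assumes "coprime L E" "L > 0" "E > 0"
  shows "card {k. k < L * E \<and> A (k mod L) \<and> B (k mod E)} = card {i. i < L \<and> A i} * card {j. j < E \<and> B j}"
proof -
  let ?f = "\<lambda>k. (k mod L, k mod E)"
  have "bij_betw ?f {k. k < L * E \<and> A (k mod L) \<and> B (k mod E)} ({i. i < L \<and> A i} \<times> {j. j < E \<and> B j})"
  proof (rule bij_betw_imageI)
    have "inj_on ?f {..<L * E}"
    proof (rule inj_onI)
      fix x y assume xy: "x \<in> {..<L * E}" "y \<in> {..<L * E}" "?f x = ?f y"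
      then have "[x = y] (mod L * E)"
        using coprime_cong_mult_nat[OF _ _ assms(1), of x y] by (simp add: cong_def)
      then show "x = y" using xy(1,2) by (simp add: cong_def)
    qed
    then show "inj_on ?f {k. k < L * E \<and> A (k mod L) \<and> B (k mod E)}"
      by (rule inj_on_subset) auto
  next
    have "(i, j) \<in> ?f ` {k. k < L * E \<and> A (k mod L) \<and> B (k mod E)}"
      if ij: "i < L" "A i" "j < E" "B j" for i j
    proof -
      obtain k where "k < L * E" "[k = i] (mod L)" "[k = j] (mod E)"
        using binary_chinese_remainder_unique_nat[OF assms(1), of i j] assms(2,3) by auto
      then show ?thesis using ij by (intro image_eqI[of _ _ k]) (auto simp: cong_def)
    qed
    then show "?f ` {k. k < L * E \<and> A (k mod L) \<and> B (k mod E)} = {i. i < L \<and> A i} \<times> {j. j < E \<and> B j}"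
      using assms(2,3) by auto
  qed
  then show ?thesis by (simp add: bij_betw_same_card card_cartesian_product)
qed

text \<open>The variant of \<open>card_gcd_eq_totient\<close> for the residues \<open>0, \<dots>, n - 1\<close>: the representatives \<open>0\<close> and \<open>n\<close>
  have the same greatest common divisor with \<open>n\<close>.\<close>

lemma card_gcd_less_eq_totient:
  fixes n d :: nat
  assumes "n > 0" "d dvd n"
  shows "card {k. k < n \<and> gcd k n = d} = totient (n div d)"
proof -
  have mod: "k mod n = (if k = n then 0 else k)" if "k \<in> {0<..n}" for k
    using that by auto
  have "bij_betw (\<lambda>k. k mod n) {k \<in> {0<..n}. gcd k n = d} {k. k < n \<and> gcd k n = d}"
  proof (rule bij_betw_imageI)
    show "inj_on (\<lambda>k. k mod n) {k \<in> {0<..n}. gcd k n = d}"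
      by (rule inj_onI) (use mod in \<open>auto split: if_splits\<close>)
    have "k \<in> (\<lambda>k. k mod n) ` {k \<in> {0<..n}. gcd k n = d}" if "k < n" "gcd k n = d" for k
      using that assms by (intro image_eqI[of _ _ "if k = 0 then n else k"]) auto
    then show "(\<lambda>k. k mod n) ` {k \<in> {0<..n}. gcd k n = d} = {k. k < n \<and> gcd k n = d}"
      using assms by auto
  qed
  from bij_betw_same_card[OF this] show ?thesis
    using card_gcd_eq_totient[OF assms] by simp
qed

text \<open>Coprimality to \<open>e\<close> is periodic, and the range consists of \<open>f\<close> full periods.\<close>

lemma card_coprime_less_mult:
  fixes e f :: nat
  assumes "e > 0"
  shows "card {k. k < f * e \<and> coprime k e} = f * totient e"
proof -
  let ?f = "\<lambda>(a, b). a * e + b"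
  have "bij_betw ?f ({..<f} \<times> {b. b < e \<and> coprime b e}) {k. k < f * e \<and> coprime k e}"
  proof (rule bij_betw_byWitness[where f' = "\<lambda>k. (k div e, k mod e)"])
    show "?f ` ({..<f} \<times> {b. b < e \<and> coprime b e}) \<subseteq> {k. k < f * e \<and> coprime k e}"
    proof clarsimp
      fix a b assume "a < f" "b < e" "coprime b e"
      have "a * e + b < Suc a * e" using \<open>b < e\<close> by simp
      also have "\<dots> \<le> f * e" using \<open>a < f\<close> by (intro mult_right_mono) auto
      finally have "a * e + b < f * e" .
      moreover have "coprime (a * e + b) e"
        using \<open>coprime b e\<close> coprime_mod_left_iff[of e "a * e + b"] coprime_mod_left_iff[of e b] assms
        by simp
      ultimately show "a * e + b < f * e \<and> coprime (a * e + b) e" by simp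
    qed
  qed (use assms in \<open>auto simp: less_mult_imp_div_less\<close>)
  from bij_betw_same_card[OF this]
  have "card {k. k < f * e \<and> coprime k e} = f * card {b. b < e \<and> coprime b e}"
    by (simp add: card_cartesian_product)
  also have "card {b. b < e \<and> coprime b e} = totient e"
    unfolding coprime_iff_gcd_eq_1 using card_gcd_less_eq_totient[of e 1] assms by simp
  finally show ?thesis .
qed

text \<open>If the left gcd divides \<open>E\<close>, then so does \<open>gcd k L\<close>, which also divides \<open>L\<close> and is therefore \<open>1\<close>;
  and factors coprime to \<open>k\<close> do not change a gcd.\<close>

lemma gcd_mult_eq_iff_of_coprime:
  fixes k L E F :: nat
  assumes "coprime L E" "F dvd E"
  shows "gcd k (L * E) = F \<longleftrightarrow> coprime k L \<and> gcd k E = F"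
proof -
  have "gcd k L = 1" if "gcd k (L * E) = F"
  proof -
    have "gcd k L dvd gcd k (L * E)" by (simp add: gcd_dvd2 dvd_mult2)
    then have "gcd k L dvd E" using that assms(2) dvd_trans by blast
    then show ?thesis using assms(1) by (meson coprime_common_divisor_nat gcd_dvd2)
  qed
  then show ?thesis
    using gcd_mult_right_left_cancel[of k L E] by (metis coprime_iff_gcd_eq_1)
qed

text \<open>Minimality moves every prime that divides \<open>a\<close> but not \<open>Q\<close> entirely into the cofactor \<open>a div D\<close>: a
  prime \<open>p\<close> shared by \<open>D\<close> and \<open>a div D\<close> does not divide \<open>Q\<close>, so \<open>D div p\<close> would still be admissible.\<close>

lemma coprime_least_cofactor:
  fixes a Q :: nat
  assumes "a > 0" and D: "D = (LEAST d. d > 0 \<and> d dvd a \<and> coprime (a div d) Q)"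
  shows "D dvd a" "coprime (D * Q) (a div D)"
proof -
  define P where "P = (\<lambda>d. d > 0 \<and> d dvd a \<and> coprime (a div d) Q)"
  have "P a" using assms(1) by (simp add: P_def)
  then have PD: "P D" and least: "\<And>d. P d \<Longrightarrow> D \<le> d"
    unfolding D P_def[symmetric] by (auto intro: LeastI Least_le)
  from PD show "D dvd a" by (simp add: P_def)
  then obtain b where b: "a = D * b" by blast
  have "D > 0" "coprime b Q" using PD b by (auto simp: P_def)
  have "coprime D b"
  proof (rule ccontr)
    assume "\<not> coprime D b"
    then obtain p where p: "Factorial_Ring.prime p" "p dvd D" "p dvd b"
      by (metis coprime_iff_gcd_eq_1 gcd_nat.bounded_iff prime_factor_nat)
    then obtain D' where D': "D = p * D'" by auto
    have "D' > 0" using \<open>D > 0\<close> D' by simp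
    have "a = D' * (p * b)" using b D' by simp
    moreover have "coprime p Q"
      using p(3) \<open>coprime b Q\<close> coprime_divisors dvd_refl by blast
    ultimately have "P D'"
      using \<open>D' > 0\<close> \<open>coprime b Q\<close> by (simp add: P_def)
    then have "D \<le> D'" by (rule least)
    moreover have "D' < D" using D' \<open>D' > 0\<close> prime_gt_1_nat[OF p(1)] by simp
    ultimately show False by simp
  qed
  then show "coprime (D * Q) (a div D)"
    using b \<open>D > 0\<close> \<open>coprime b Q\<close> by (simp add: coprime_commute)
qed

section \<open>Exponents of a primitive element\<close>

lemma (in field) ord_primitive:
  assumes "finite (carrier R)" "g \<in> carrier (Multiplicative_Group.mult_of R)" "carrier (Multiplicative_Group.mult_of R) = {g [^] i | i::nat. i \<in> UNIV}"
  shows "group.ord (Multiplicative_Group.mult_of R) g = order R - 1"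
proof -
  interpret M: group "Multiplicative_Group.mult_of R" by (rule field_mult_group)
  have fin: "finite (carrier (Multiplicative_Group.mult_of R))" using assms(1) by simp
  have "carrier (Multiplicative_Group.mult_of R) = generate (Multiplicative_Group.mult_of R) {g}"
    using M.generate_pow_on_finite_carrier[OF fin assms(2)] assms(3) by (simp add: Multiplicative_Group.nat_pow_mult_of)
  then show ?thesis
    using M.generate_pow_card[OF assms(2)] order_mult_of[OF assms(1)] by (simp add: order_def)
qed

lemma (in field) bij_betw_primitive_pow:
  assumes "finite (carrier R)" "g \<in> carrier (Multiplicative_Group.mult_of R)" "carrier (Multiplicative_Group.mult_of R) = {g [^] i | i::nat. i \<in> UNIV}"
  shows "bij_betw (\<lambda>k::nat. g [^] k) {..<order R - 1} (carrier R - {\<zero>})"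
proof -
  interpret M: group "Multiplicative_Group.mult_of R" by (rule field_mult_group)
  have fin: "finite (carrier (Multiplicative_Group.mult_of R))" using assms(1) by simp
  have n: "M.ord g = order R - 1" by (rule ord_primitive) fact+
  have pos: "M.ord g > 0" using M.ord_ge_1[OF fin assms(2)] by simp
  have S: "{0..M.ord g - 1} = {..<order R - 1}" using pos n by auto
  show ?thesis
    unfolding bij_betw_def
    using M.ord_inj[OF assms(2)] M.ord_elems[OF fin assms(2)] assms(3)
    unfolding S by (auto simp: Multiplicative_Group.nat_pow_mult_of)
qed

text \<open>As \<open>d\<close> divides the group order, being a \<open>d\<close>-th power is visible on exponents: \<open>g ^ k\<close> is a
  \<open>d\<close>-th power iff \<open>d\<close> divides \<open>k\<close>. So \<open>N\<close>-freeness says that \<open>k\<close> and \<open>N\<close> have no common divisor but \<open>1\<close>.\<close>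

lemma (in field) N_free_primitive_pow_iff:
  assumes "finite (carrier R)" "g \<in> carrier (Multiplicative_Group.mult_of R)" "carrier (Multiplicative_Group.mult_of R) = {g [^] i | i::nat. i \<in> UNIV}"
    and N: "N dvd order R - 1"
  shows "N_free R N (g [^] k) \<longleftrightarrow> coprime k N"
proof -
  interpret M: group "Multiplicative_Group.mult_of R" by (rule field_mult_group)
  have g: "g \<in> carrier R" "g \<noteq> \<zero>" using assms(2) by auto
  have n: "M.ord g = order R - 1" by (rule ord_primitive) fact+
  have nz: "g [^] j \<in> carrier R - {\<zero>}" for j :: nat
    using M.nat_pow_closed[OF assms(2), of j] by (simp add: Multiplicative_Group.nat_pow_mult_of)
  have root: "(\<exists>\<gamma>\<in>carrier R. g [^] k = \<gamma> [^] d) \<longleftrightarrow> d dvd k" if d: "d dvd N" for d :: nat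
  proof
    assume "d dvd k"
    then obtain j where "k = j * d" by (metis dvdE mult.commute)
    then have "g [^] k = (g [^] j) [^] d" using g by (simp add: nat_pow_pow)
    then show "\<exists>\<gamma>\<in>carrier R. g [^] k = \<gamma> [^] d" using nz by blast
  next
    assume "\<exists>\<gamma>\<in>carrier R. g [^] k = \<gamma> [^] d"
    then obtain \<gamma> where \<gamma>: "\<gamma> \<in> carrier R" "g [^] k = \<gamma> [^] d" by blast
    have dn: "d dvd order R - 1" using d N dvd_trans by blast
    have "order R - 1 \<noteq> 0" using M.ord_ge_1[OF _ assms(2)] assms(1) n by simp
    then have "d \<noteq> 0" using dn by (metis dvd_0_left)
    have "\<gamma> \<noteq> \<zero>"
      using \<gamma> nz[of k] nat_pow_zero[OF \<open>d \<noteq> 0\<close>] by auto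
    then have "\<gamma> \<in> carrier (Multiplicative_Group.mult_of R)" using \<gamma> by simp
    then obtain j :: nat where "\<gamma> = g [^] j" using assms(3) by auto
    then have "g [^] k = g [^] (j * d)" using \<gamma> g by (simp add: nat_pow_pow)
    then have "int (order R - 1) dvd int (j * d) - int k"
      using M.int_pow_eq[OF assms(2), of "int k" "int (j * d)"] n
      by (simp add: int_pow_int Multiplicative_Group.nat_pow_mult_of del: of_nat_mult)
    then have "int d dvd int (j * d) - int k" using dn by (meson dvd_trans int_dvd_int_iff)
    moreover have "int d dvd int (j * d)" by simp
    ultimately have "int d dvd int k" by (metis dvd_diff_right_iff)
    then show "d dvd k" by simp
  qed
  have "N_free R N (g [^] k) \<longleftrightarrow> (\<forall>d. d dvd N \<longrightarrow> d dvd k \<longrightarrow> d = 1)"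
    unfolding N_free_def using nz root by auto
  also have "\<dots> \<longleftrightarrow> coprime k N"
    by (auto simp: coprime_def)
  finally show ?thesis .
qed

lemma (in field) ord_primitive_pow_eq_iff:
  assumes "finite (carrier R)" "g \<in> carrier (Multiplicative_Group.mult_of R)" "carrier (Multiplicative_Group.mult_of R) = {g [^] i | i::nat. i \<in> UNIV}"
    and N: "order R - 1 = N * F"
  shows "group.ord (Multiplicative_Group.mult_of R) (g [^] k) = N \<longleftrightarrow> gcd k (order R - 1) = F"
proof -
  interpret M: group "Multiplicative_Group.mult_of R" by (rule field_mult_group)
  have n: "M.ord g = order R - 1" by (rule ord_primitive) fact+
  have pos: "N * F > 0" using M.ord_ge_1[OF _ assms(2)] assms(1) n N by simp
  have "M.ord (g [^] k) = (N * F) div gcd k (N * F)"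
    using M.ord_pow_gen[OF assms(2), of k] n N pos by (simp add: Multiplicative_Group.nat_pow_mult_of gcd.commute)
  moreover have "(N * F) div gcd k (N * F) = N \<longleftrightarrow> gcd k (N * F) = F"
  proof
    assume "(N * F) div gcd k (N * F) = N"
    then have "N * F = N * gcd k (N * F)"
      by (metis dvd_mult_div_cancel gcd_dvd2 mult.commute)
    then show "gcd k (N * F) = F" using pos by simp
  qed (use pos in simp)
  ultimately show ?thesis using N by simp
qed

section \<open>The trace\<close>

lemma (in field) field_trace_closed:
  "x \<in> carrier R \<Longrightarrow> field_trace R q m x \<in> carrier R"
  unfolding field_trace_def by (rule finsum_closed) auto

text \<open>The scalars are the fixed points of \<open>x \<mapsto> x ^ q\<close>, hence of all its iterates, so \<open>c\<close> factors out of
  every conjugate in the sum.\<close>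

lemma (in field) field_trace_smult:
  assumes "c \<in> carrier R" "x \<in> carrier R" "c [^] q = c"
  shows "field_trace R q m (c \<otimes> x) = c \<otimes> field_trace R q m x"
proof -
  have c: "c [^] (q ^ i) = c" for i :: nat
  proof (induction i)
    case (Suc i)
    have "c [^] (q ^ Suc i) = (c [^] q) [^] (q ^ i)" using assms(1) by (simp add: nat_pow_pow)
    then show ?case using Suc assms(3) by simp
  qed (use assms in simp)
  show ?thesis
    unfolding field_trace_def
    using assms by (subst finsum_rdistr) (auto simp: nat_pow_distrib c)
qed

text \<open>Changing \<open>k\<close> by a multiple of \<open>L\<close> multiplies the power by some \<open>c = g ^ (L * j)\<close>, and
  \<open>c ^ (q - 1) = \<one>\<close>: a non-zero scalar, which does not affect the vanishing of the trace.\<close>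

lemma (in field) field_trace_pow_eq_zero_iff_mod:
  assumes "g \<in> carrier (Multiplicative_Group.mult_of R)" "g [^] ((q - 1) * L) = \<one>" "q > 0"
  shows "field_trace R q m (g [^] k) = \<zero> \<longleftrightarrow> field_trace R q m (g [^] (k mod L)) = \<zero>"
proof -
  interpret M: group "Multiplicative_Group.mult_of R" by (rule field_mult_group)
  define c where "c = g [^] (L * (k div L))"
  have g: "g \<in> carrier R" using assms(1) by simp
  have c: "c \<in> carrier R" "c \<noteq> \<zero>"
    using M.nat_pow_closed[OF assms(1), of "L * (k div L)"] by (auto simp: Multiplicative_Group.nat_pow_mult_of c_def)
  have "c [^] (q - 1) = (g [^] ((q - 1) * L)) [^] (k div L)"
    using g by (simp add: c_def nat_pow_pow mult_ac)
  then have c1: "c [^] (q - 1) = \<one>" using assms(2) by simp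
  have "c [^] q = c [^] Suc (q - 1)" using assms(3) by simp
  also have "\<dots> = c" using c1 c by simp
  finally have cq: "c [^] q = c" .
  have "g [^] k = c \<otimes> g [^] (k mod L)"
    using g by (simp add: c_def nat_pow_mult)
  then have "field_trace R q m (g [^] k) = c \<otimes> field_trace R q m (g [^] (k mod L))"
    using field_trace_smult[OF c(1) _ cq] g by simp
  then show ?thesis
    using c g field_trace_closed integral_iff by simp
qed

section \<open>Elements of trace zero\<close>

text \<open>Both counts are taken over exponents and factored along \<open>L * (e * f)\<close>. The part modulo \<open>L\<close> carries
  the trace condition and coprimality to \<open>L\<close>, and gives the same \<open>T\<close> in both cases; the part modulo \<open>e * f\<close>
  is a pure counting of residues.\<close>

lemma (in field) trace_zero_counts:
  fixes q m L e f :: nat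
  assumes fin: "finite (carrier R)" and g: "g \<in> carrier (Multiplicative_Group.mult_of R)"
    and gen: "carrier (Multiplicative_Group.mult_of R) = {g [^] i | i::nat. i \<in> UNIV}"
    and n: "order R - 1 = L * (e * f)" and cop: "coprime L (e * f)"
    and q: "q > 0" and dvd: "order R - 1 dvd (q - 1) * L"
  defines "T \<equiv> card {i. i < L \<and> coprime i L \<and> field_trace R q m (g [^] i) = \<zero>}"
  shows "Z_count R q m (L * e) \<zero> = f * totient e * T"
    and "P_count R q m (L * e) \<zero> = totient e * T"
proof -
  interpret M: group "Multiplicative_Group.mult_of R" by (rule field_mult_group)
  have ord: "M.ord g = order R - 1" by (rule ord_primitive) fact+
  have pos: "L > 0" "e > 0" "f > 0"
    using M.ord_ge_1[OF _ g] fin ord n by auto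
  let ?tr = "\<lambda>k. field_trace R q m (g [^] k) = \<zero>"
  have one: "g [^] ((q - 1) * L) = \<one>"
    using M.pow_eq_id[OF g] dvd ord by (simp add: Multiplicative_Group.nat_pow_mult_of)
  have tr: "?tr k \<longleftrightarrow> ?tr (k mod L)" for k
    by (rule field_trace_pow_eq_zero_iff_mod[OF g one q])
  have bij: "bij_betw (\<lambda>k::nat. g [^] k) {..<L * (e * f)} (carrier R - {\<zero>})"
    using bij_betw_primitive_pow[OF fin g gen] unfolding n .
  have count: "card {x \<in> carrier R - {\<zero>}. A x} = card {k. k < L * (e * f) \<and> A (g [^] k)}" for A
  proof -
    have "bij_betw (\<lambda>k::nat. g [^] k) {k. k < L * (e * f) \<and> A (g [^] k)} {x \<in> carrier R - {\<zero>}. A x}"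
    proof (rule bij_betw_subset[OF bij])
      have surj: "carrier R - {\<zero>} = (\<lambda>k::nat. g [^] k) ` {..<L * (e * f)}"
        using bij_betw_imp_surj_on[OF bij] by (rule sym)
      show "(\<lambda>k. g [^] k) ` {k. k < L * (e * f) \<and> A (g [^] k)} = {x \<in> carrier R - {\<zero>}. A x}"
        unfolding surj by auto
    qed auto
    from bij_betw_same_card[OF this] show ?thesis by (rule sym)
  qed
  have copL: "coprime k L \<longleftrightarrow> coprime (k mod L) L" for k
    using coprime_mod_left_iff[of L k] pos by simp
  have cope: "coprime k e \<longleftrightarrow> coprime (k mod (e * f)) e" for k
    using coprime_mod_left_iff[of e k] coprime_mod_left_iff[of e "k mod (e * f)"] pos
    by (simp add: mod_mod_cancel)
  have "N_free R (L * e) (g [^] k) \<longleftrightarrow> coprime k L \<and> coprime k e" for k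
    using N_free_primitive_pow_iff[OF fin g gen, of "L * e" k] n by simp
  then have free: "N_free R (L * e) (g [^] k) \<longleftrightarrow> coprime (k mod L) L \<and> coprime (k mod (e * f)) e" for k
    using copL[of k] cope[of k] by blast
  have "(N_free R (L * e) (g [^] k) \<and> ?tr k) \<longleftrightarrow>
      ((coprime (k mod L) L \<and> ?tr (k mod L)) \<and> coprime (k mod (e * f)) e)" for k
    using free[of k] tr[of k] by blast
  then have "Z_count R q m (L * e) \<zero> =
      card {k. k < L * (e * f) \<and> (coprime (k mod L) L \<and> ?tr (k mod L)) \<and> coprime (k mod (e * f)) e}"
    unfolding Z_count_def count by presburger
  also have "\<dots> = T * card {j. j < f * e \<and> coprime j e}"
    unfolding T_def using pos by (subst card_residue_pairs[OF cop]) (auto simp: mult.commute)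
  finally show "Z_count R q m (L * e) \<zero> = f * totient e * T"
    using card_coprime_less_mult[OF pos(2)] by simp
  have ord_iff: "M.ord (g [^] k) = L * e \<longleftrightarrow> coprime k L \<and> gcd k (e * f) = f" for k
    using ord_primitive_pow_eq_iff[OF fin g gen, of "L * e" f k] n
      gcd_mult_eq_iff_of_coprime[OF cop, of f k] by (simp add: mult_ac)
  have order: "M.ord (g [^] k) = L * e \<longleftrightarrow> coprime (k mod L) L \<and> gcd (k mod (e * f)) (e * f) = f" for k
    unfolding ord_iff copL[of k] using gcd_mod_left[of "e * f" k] pos by simp
  have "(M.ord (g [^] k) = L * e \<and> ?tr k) \<longleftrightarrow>
      ((coprime (k mod L) L \<and> ?tr (k mod L)) \<and> gcd (k mod (e * f)) (e * f) = f)" for k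
    by (simp only: order[of k] tr[of k] conj_ac)
  then have "P_count R q m (L * e) \<zero> =
      card {k. k < L * (e * f) \<and> (coprime (k mod L) L \<and> ?tr (k mod L)) \<and> gcd (k mod (e * f)) (e * f) = f}"
    unfolding P_count_def count by presburger
  also have "\<dots> = T * card {j. j < e * f \<and> gcd j (e * f) = f}"
    unfolding T_def using pos by (subst card_residue_pairs[OF cop]) auto
  also have "card {j. j < e * f \<and> gcd j (e * f) = f} = totient e"
    using pos by (subst card_gcd_less_eq_totient) auto
  finally show "P_count R q m (L * e) \<zero> = totient e * T" by simp
qed

theorem lemma6p3:
  fixes R :: "('a, 'b) ring_scheme" and q m Q D :: nat
  assumes "primepow q" and "m > 0"
    and "field R" and "order R = q ^ m"
    and "Q = (q ^ m - 1) div (q - 1)"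
    and "D = (LEAST d. d > 0 \<and> d dvd q - 1 \<and> coprime ((q - 1) div d) Q)"
  shows "(\<forall>N::nat. N dvd q ^ m - 1 \<longrightarrow> D * Q dvd N \<longrightarrow>
            real (Z_count R q m N \<zero>\<^bsub>R\<^esub>) = real (q ^ m - 1) / real N * real (P_count R q m N \<zero>\<^bsub>R\<^esub>)) \<and>
         real (P_count R q m (q ^ m - 1) \<zero>\<^bsub>R\<^esub>) =
            real (totient (q ^ m - 1)) / real (totient (D * Q)) * real (P_count R q m (D * Q) \<zero>\<^bsub>R\<^esub>)"
proof -
  interpret field R by fact
  have q: "q > 1" using primepow_gt_Suc_0[OF assms(1)] by simp
  then have n_pos: "q ^ m - 1 > 0" using one_less_power[of q m] assms(2) by linarith
  have fin: "finite (carrier R)"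
    using assms(4) q by (intro card_ge_0_finite) (simp add: order_def)
  obtain g where g: "g \<in> carrier (Multiplicative_Group.mult_of R)" 
    and gen: "carrier (Multiplicative_Group.mult_of R) = {g [^]\<^bsub>R\<^esub> i | i::nat. i \<in> UNIV}"
    using finite_field_mult_group_has_gen[OF fin] by auto
  have ordR: "order R - 1 = q ^ m - 1" using assms(4) by simp
  have "int (q - 1) dvd int (q ^ m - 1)"
    using q power_diff_1_eq[of "int q" m] by (simp add: of_nat_diff)
  then have nQ: "q ^ m - 1 = (q - 1) * Q"
    using assms(5) by (simp only: int_dvd_int_iff) simp
  define L E where "L = D * Q" and "E = (q - 1) div D"
  have D: "D dvd q - 1" and cop: "coprime L E"
    using coprime_least_cofactor[OF _ assms(6)] q by (auto simp: L_def E_def)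
  have nL: "q ^ m - 1 = L * E" using nQ D by (simp add: L_def E_def mult_ac)
  have pos: "L > 0" "E > 0" using n_pos unfolding nL by auto
  have dvd: "order R - 1 dvd (q - 1) * L"
    unfolding ordR nQ L_def by (simp add: mult_ac)
  define T where "T = card {i. i < L \<and> coprime i L \<and> field_trace R q m (g [^]\<^bsub>R\<^esub> i) = \<zero>\<^bsub>R\<^esub>}"
  have counts: "Z_count R q m (L * e) \<zero>\<^bsub>R\<^esub> = f * totient e * T" "P_count R q m (L * e) \<zero>\<^bsub>R\<^esub> = totient e * T"
    if "E = e * f" for e f
    using trace_zero_counts[OF fin g gen _ _ _ dvd, where e = e and f = f and m = m]
      that nL ordR cop q by (simp_all add: T_def)
  have "real (Z_count R q m N \<zero>\<^bsub>R\<^esub>) = real (q ^ m - 1) / real N * real (P_count R q m N \<zero>\<^bsub>R\<^esub>)"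
    if N: "N dvd q ^ m - 1" "D * Q dvd N" for N
  proof -
    obtain e where e: "N = L * e" using N(2) unfolding L_def by auto
    have "e dvd E" using N(1) pos unfolding nL e by simp
    then obtain f where f: "E = e * f" by auto
    then have "real (q ^ m - 1) / real N = real f"
      using pos unfolding nL e by simp
    then show ?thesis using counts[OF f] e by simp
  qed
  moreover have "real (P_count R q m (q ^ m - 1) \<zero>\<^bsub>R\<^esub>) =
      real (totient (q ^ m - 1)) / real (totient (D * Q)) * real (P_count R q m (D * Q) \<zero>\<^bsub>R\<^esub>)"
  proof -
    have "P_count R q m (q ^ m - 1) \<zero>\<^bsub>R\<^esub> = totient E * T" using counts(2)[of E 1] nL by simp
    moreover have "P_count R q m (D * Q) \<zero>\<^bsub>R\<^esub> = T" using counts(2)[of 1 E] by (simp add: L_def)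
    moreover have "totient (q ^ m - 1) = totient (D * Q) * totient E"
      using totient_mult_coprime[OF cop] nL by (simp add: L_def)
    moreover have "totient (D * Q) > 0" using pos by (simp add: L_def)
    ultimately show ?thesis by simp
  qed
  ultimately show ?thesis by blast
qed

end
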